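(* Let $n\geq 2$ and $1\leq k\leq n-1$. The cycle-prefix digraph $\mathrm{CP}(n,k)=\mathcal{G}(S_n,H_k,\{\gamma(2),\ldots,\gamma(n-k+1)\})$ is optimally vertex connected, i.e. its vertex connectivity equals its degree $n-1$.
   Context: $S_n$ is the group of permutations of $\{1,\ldots,n\}$. A permutation $\pi$ mapping $i$ to $\pi_i$ is written $\pi=\pi_1\pi_2\ldots\pi_n$; permutations act on the right ($i\pi=\pi_i$) and compose by $i(\pi\sigma)=(i\pi)\sigma$. For $2\le j\le n$, $\gamma(j)=j\,1\,2\ldots(j-1)(j+1)\ldots n$ is the permutation cyclically permuting $\{1,\ldots,j\}$ to the right and fixing all other points. $H_k$ is the subgroup of $S_n$ of permutations $\pi$ with $\pi_i=i$ for all $i\leq n-k$. For a group $G$, subgroup $H$ and $S\subseteq G\setminus H$, the Cayley coset digraph $\mathcal{G}(G,H,S)$ has vertex set the left cosets $gH$, with $(gH,g'H)$ an edge iff $gHs\cap g'H\neq\emptyset$ for some $s\in S$; $\mathrm{CP}(n,k)$ has out-degree $n-1$ at every vertex. The vertex connectivity is the smallest number of vertices whose removal leaves a digraph that is not strongly connected (for a complete digraph on $m$ vertices it is taken to be $m-1$). *)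

theory Defs
  imports
    "HOL-Algebra.Left_Coset"
    "HOL-Algebra.Sym_Groups"
    "Graph_Theory.Digraph_Component"
begin

text \<open>\<^const>\<open>sym_group\<close> multiplies by \<open>\<pi> \<circ> \<sigma>\<close>. Permutations here act on the right,
  \<open>i(\<pi>\<sigma>) = (i\<pi>)\<sigma>\<close>, so the product is reversed. This matters for what a left coset is.\<close>

definition right_sym_group :: "nat \<Rightarrow> (nat \<Rightarrow> nat) monoid" where
  "right_sym_group n = (sym_group n)\<lparr>mult := \<lambda>\<pi> \<sigma>. \<sigma> \<circ> \<pi>\<rparr>"

definition prefix_cycle :: "nat \<Rightarrow> nat \<Rightarrow> nat" where
  "prefix_cycle j i = (if i = 1 then j else if 2 \<le> i \<and> i \<le> j then i - 1 else i)"

definition prefix_fixing :: "nat \<Rightarrow> nat \<Rightarrow> (nat \<Rightarrow> nat) set" where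
  "prefix_fixing n k = {\<pi> \<in> carrier (right_sym_group n). \<forall>i\<in>{1..n - k}. \<pi> i = i}"

definition cayley_coset_digraph ::
    "('a, 'b) monoid_scheme \<Rightarrow> 'a set \<Rightarrow> 'a set \<Rightarrow> ('a set, 'a set \<times> 'a set) pre_digraph" where
  "cayley_coset_digraph G H S = with_proj
     \<lparr>pverts = lcosets\<^bsub>G\<^esub> H,
      parcs = {(g <#\<^bsub>G\<^esub> H, g' <#\<^bsub>G\<^esub> H) | g g'. g \<in> carrier G \<and> g' \<in> carrier G \<and>
        (\<exists>s\<in>S. ((g <#\<^bsub>G\<^esub> H) #>\<^bsub>G\<^esub> s) \<inter> (g' <#\<^bsub>G\<^esub> H) \<noteq> {})}\<rparr>"

definition cycle_prefix_digraph ::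
    "nat \<Rightarrow> nat \<Rightarrow> ((nat \<Rightarrow> nat) set, (nat \<Rightarrow> nat) set \<times> (nat \<Rightarrow> nat) set) pre_digraph" where
  "cycle_prefix_digraph n k =
     cayley_coset_digraph (right_sym_group n) (prefix_fixing n k) (prefix_cycle ` {2..n - k + 1})"

text \<open>Intended for finite digraphs. The empty digraph is not \<^const>\<open>strongly_connected\<close>, but this
  does not influence the minimum: in a digraph that is not complete, deleting all vertices except
  two suitable ones already destroys strong connectivity.\<close>

definition vertex_connectivity :: "('a, 'b) pre_digraph \<Rightarrow> nat" where
  "vertex_connectivity G =
     (if \<forall>u\<in>verts G. \<forall>v\<in>verts G. u \<noteq> v \<longrightarrow> u \<rightarrow>\<^bsub>G\<^esub> v
      then card (verts G) - 1
      else LEAST c. \<exists>X. X \<subseteq> verts G \<and> finite X \<and> card X = c \<and>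
             \<not> strongly_connected (G \<restriction> (verts G - X)))"

lemma group_right_sym_group: "group (right_sym_group n)"
proof (rule groupI)
  fix \<pi> assume "\<pi> \<in> carrier (right_sym_group n)"
  then have "\<pi> permutes {1..n}"
    by (simp add: right_sym_group_def sym_group_def)
  then have "Hilbert_Choice.inv \<pi> permutes {1..n}" "\<pi> \<circ> Hilbert_Choice.inv \<pi> = id"
    by (simp_all add: permutes_inv permutes_inv_o)
  then show "\<exists>\<sigma>\<in>carrier (right_sym_group n).
      \<sigma> \<otimes>\<^bsub>right_sym_group n\<^esub> \<pi> = \<one>\<^bsub>right_sym_group n\<^esub>"
    by (auto simp: right_sym_group_def sym_group_def)
qed (auto simp: right_sym_group_def sym_group_def permutes_compose permutes_id comp_assoc)

lemma subgroup_prefix_fixing: "subgroup (prefix_fixing n k) (right_sym_group n)"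
proof (rule group.subgroupI[OF group_right_sym_group])
  show "prefix_fixing n k \<noteq> {}"
    by (auto simp: prefix_fixing_def right_sym_group_def sym_group_def
        intro!: exI[of _ id] permutes_id)
next
  fix \<pi> assume \<pi>: "\<pi> \<in> prefix_fixing n k"
  then have p: "\<pi> permutes {1..n}" and fx: "\<forall>i\<in>{1..n - k}. \<pi> i = i"
    by (auto simp: prefix_fixing_def right_sym_group_def sym_group_def)
  have "inv\<^bsub>right_sym_group n\<^esub> \<pi> = Hilbert_Choice.inv \<pi>"
    using p by (intro group.inv_equality[OF group_right_sym_group])
      (auto simp: right_sym_group_def sym_group_def permutes_inv permutes_inv_o)
  moreover have "\<forall>i\<in>{1..n - k}. Hilbert_Choice.inv \<pi> i = i"
    using fx p by (metis permutes_inverses(2))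
  ultimately show "inv\<^bsub>right_sym_group n\<^esub> \<pi> \<in> prefix_fixing n k"
    using p by (simp add: prefix_fixing_def right_sym_group_def sym_group_def permutes_inv)
qed (auto simp: prefix_fixing_def right_sym_group_def sym_group_def permutes_compose)

lemma prefix_cycle_permutes:
  assumes "2 \<le> j" "j \<le> n"
  shows "prefix_cycle j permutes {1..n}"
proof (rule bij_imp_permutes)
  show "bij_betw (prefix_cycle j) {1..n} {1..n}"
    by (rule bij_betw_byWitness[where f' = "\<lambda>i. if i = j then 1 else if i < j then i + 1 else i"])
      (use assms in \<open>auto simp: prefix_cycle_def split: if_splits\<close>)
qed (use assms in \<open>auto simp: prefix_cycle_def\<close>)

lemma prefix_cycles_not_fixing:
  assumes "1 \<le> k" "k \<le> n - 1"
  shows "prefix_cycle ` {2..n - k + 1} \<subseteq> carrier (right_sym_group n) - prefix_fixing n k"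
proof
  fix s assume "s \<in> prefix_cycle ` {2..n - k + 1}"
  then obtain j where j: "s = prefix_cycle j" "2 \<le> j" "j \<le> n - k + 1" by auto
  have "s permutes {1..n}" using j assms prefix_cycle_permutes by simp
  moreover have "s 1 \<noteq> 1" using j by (simp add: prefix_cycle_def)
  moreover have "1 \<in> {1..n - k}" using assms by auto
  ultimately show "s \<in> carrier (right_sym_group n) - prefix_fixing n k"
    unfolding prefix_fixing_def by (auto simp: right_sym_group_def sym_group_def)
qed

end

theory Submission
  imports Defs
begin

text \<open>
  A coset \<open>g H\<^sub>k\<close> is determined by the word \<open>x = (g\<^sup>-\<^sup>1 1, \<dots>, g\<^sup>-\<^sup>1 m)\<close> of \<open>m = n - k\<close> distinct
  letters. An arc removes the first letter of \<open>x\<close> and either reinserts it further back or appends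
  a letter not in \<open>x\<close>; in the opposite direction, an arbitrary letter other than the first is
  moved to the front (dropping the last letter if it is new).

  Delete a set \<open>X\<close> of at most \<open>n - 2\<close> words. Connectivity follows by induction on \<open>m\<close>. At least two
  letters are not the first letter of any word of \<open>X\<close>, and one of them, \<open>a\<close>, is the second letter
  of at most \<open>n - 3\<close> words of \<open>X\<close>. The words \<open>a y\<close> form a copy of the digraph for \<open>n - 1\<close> and
  \<open>m - 1\<close>: an arc from \<open>z t\<close> is realised by the path through \<open>z a t\<close>. By induction those \<open>a z t\<close>
  with \<open>z a t\<close> not in \<open>X\<close> are mutually reachable. Every remaining word is reachable from one of
  these by moving \<open>a\<close> to the front, and reaches one of these by a counting argument.
\<close>

section \<open>Words and their shifts\<close>

definition words :: "'a set \<Rightarrow> nat \<Rightarrow> 'a list set" where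
  "words S m = {x. length x = m \<and> distinct x \<and> set x \<subseteq> S}"

text \<open>Index \<open>0\<close> is left out because it would give back \<open>x\<close>; the
  largest index, \<open>length x - 1\<close>, puts the first letter last. Reinsertion at index
  \<open>j\<close> comes from the generator \<open>prefix_cycle (j + 1)\<close>, appending from the
  longest generator.\<close>

definition shifts :: "'a set \<Rightarrow> 'a list \<Rightarrow> 'a list set" where
  "shifts S x = (\<lambda>j. take j (tl x) @ hd x # drop j (tl x)) ` {1..<length x}
     \<union> (\<lambda>w. tl x @ [w]) ` (S - set x)"

text \<open>The in-neighbours of \<open>x\<close>, for \<open>z\<close> other than its first letter.
  On distinct words \<open>take\<close> drops a letter exactly when \<open>z\<close> is new.\<close>

definition to_front :: "'a \<Rightarrow> 'a list \<Rightarrow> 'a list" where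
  "to_front z x = take (length x) (z # removeAll z x)"

lemma wordsD:
  assumes "x \<in> words S m"
  shows "length x = m" "distinct x" "set x \<subseteq> S"
  using assms by (auto simp: words_def)

lemma Cons_in_words_iff:
  "z # x \<in> words S (Suc m) \<longleftrightarrow> z \<in> S \<and> x \<in> words (S - {z}) m"
  by (auto simp: words_def)

lemma words_Suc_cases:
  assumes "x \<in> words S (Suc m)"
  obtains z y where "x = z # y" "z \<in> S" "y \<in> words (S - {z}) m"
  using assms by (cases x) (auto simp: words_def)

lemma finite_words:
  assumes "finite S"
  shows "finite (words S m)"
proof (rule finite_subset)
  show "words S m \<subseteq> {x. set x \<subseteq> S \<and> length x = m}"
    by (auto simp: words_def)
qed (rule finite_lists_length_eq[OF assms])

lemma words_nonempty:
  assumes "finite S" "m \<le> card S"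
  shows "words S m \<noteq> {}"
proof -
  obtain A where A: "A \<subseteq> S" "card A = m"
    using assms obtain_subset_with_card_n by metis
  obtain x where "set x = A" "distinct x"
    using finite_distinct_list finite_subset[OF A(1) assms(1)] by blast
  then have "x \<in> words S m"
    using A distinct_card by (fastforce simp: words_def)
  then show ?thesis by blast
qed

lemma ex_word_starting_with:
  assumes "finite S" "1 \<le> m" "m \<le> card S" "c \<in> S"
  obtains x where "x \<in> words S m" "hd x = c"
proof -
  obtain m' where m': "m = Suc m'" using assms(2) by (cases m) auto
  have "words (S - {c}) m' \<noteq> {}"
    using assms by (intro words_nonempty) (auto simp: m' card_Diff_singleton)
  then obtain y where "y \<in> words (S - {c}) m'" by blast
  then show ?thesis using that[of "c # y"] assms(4) by (simp add: m' Cons_in_words_iff)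
qed

lemma shifts_in_words:
  assumes "x \<in> words S m" "y \<in> shifts S x" "x \<noteq> []"
  shows "y \<in> words S m"
proof -
  obtain c t where x: "x = c # t"
    using assms(3) by (cases x) auto
  note xD = wordsD[OF assms(1)]
  from assms(2) consider (ins) j where "j < Suc (length t)" "y = take j t @ c # drop j t"
    | (app) w where "w \<in> S - set x" "y = t @ [w]"
    by (auto simp: shifts_def x)
  then show ?thesis
  proof cases
    case ins
    have "mset y = mset x"
    proof -
      have "mset (take j t) + mset (drop j t) = mset t"
        by (metis append_take_drop_id mset_append)
      then show ?thesis by (simp add: ins x)
    qed
    then have "length y = length x" "distinct y = distinct x" "set y = set x"
      by (metis size_mset, metis mset_eq_imp_distinct_iff, metis set_mset_mset)
    then show ?thesis
      using xD by (simp add: words_def)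
  next
    case app
    then show ?thesis using xD by (auto simp: words_def x)
  qed
qed

lemma finite_shifts: "finite S \<Longrightarrow> finite (shifts S x)"
  by (simp add: shifts_def)

text \<open>The \<open>m - 1\<close> reinsertions differ in the position of the first letter, the
  \<open>card S - m\<close> appended words in their last letter, and only the former still contain
  the first letter. The length \<open>m\<close> cancels in the sum.\<close>

lemma card_shifts:
  assumes "finite S" "x \<in> words S m" "x \<noteq> []"
  shows "card (shifts S x) = card S - 1"
proof -
  obtain c t where x: "x = c # t"
    using assms(3) by (cases x) auto
  note xD = wordsD[OF assms(2)]
  let ?f = "\<lambda>j. take j t @ c # drop j t" and ?g = "\<lambda>w. t @ [w]"
  have nth: "?f j ! j = c" if "j \<in> {1..<length x}" for j
    using that by (auto simp: nth_append x)
  have len: "length (?f j) = length x" if "j \<in> {1..<length x}" for j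
    using that by (auto simp: x)
  have dist: "distinct (?f j)" if "j \<in> {1..<length x}" for j
    using shifts_in_words[OF assms(2) _ assms(3), of "?f j"] that
    by (auto simp: shifts_def x words_def)
  have inj: "inj_on ?f {1..<length x}"
  proof (rule inj_onI)
    fix i j assume ij: "i \<in> {1..<length x}" "j \<in> {1..<length x}" "?f i = ?f j"
    then have "?f i ! i = ?f i ! j" using nth by metis
    then show "i = j"
      using nth_eq_iff_index_eq[OF dist[OF ij(1)]] len[OF ij(1)] ij by auto
  qed
  have "?f ` {1..<length x} \<inter> ?g ` (S - set x) = {}"
  proof -
    have "c \<in> set (?f j)" for j by simp
    moreover have "c \<notin> set (?g w)" if "w \<in> S - set x" for w
      using that xD by (auto simp: x)
    ultimately have "?f j \<noteq> ?g w" if "w \<in> S - set x" for j w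
      using that by metis
    then show ?thesis unfolding disjoint_iff by (metis (lifting) imageE)
  qed
  then have "card (shifts S x) = card (?f ` {1..<length x}) + card (?g ` (S - set x))"
    unfolding shifts_def x list.sel using assms(1) by (subst card_Un_disjoint) (auto simp: x)
  also have "\<dots> = (length x - 1) + (card S - length x)"
    using inj assms(1) xD distinct_card[OF xD(2)]
    by (subst (1 2) card_image) (auto simp: card_Diff_subset inj_on_def)
  also have "\<dots> = card S - 1"
    using card_mono[OF assms(1) xD(3)] distinct_card[OF xD(2)] by (simp add: x)
  finally show ?thesis .
qed

text \<open>As reinsertion starts at index 1, the second letter always moves up to the front. All
  out-neighbours of a word thus share their first letter.\<close>

lemma hd_shifts:
  assumes "x \<in> words S m" "2 \<le> m" "y \<in> shifts S x"
  shows "hd y = x ! 1"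
proof -
  obtain c d t where x: "x = c # d # t"
    using assms wordsD(1)[OF assms(1)] by (cases x; cases "tl x") auto
  from assms(3) show ?thesis
    by (auto simp: shifts_def x hd_append take_Cons split: nat.splits)
qed

section \<open>In-neighbours of a word\<close>

lemma hd_to_front: "x \<noteq> [] \<Longrightarrow> hd (to_front z x) = z"
  by (cases x) (auto simp: to_front_def)

lemma to_front_in_words:
  assumes "x \<in> words S m" "z \<in> S"
  shows "to_front z x \<in> words S m"
proof (cases "z \<in> set x")
  case True
  then obtain ps qs where x: "x = ps @ z # qs" by (meson split_list)
  with wordsD[OF assms(1)] assms(2) show ?thesis
    by (auto simp: to_front_def words_def)
next
  case False
  then have "to_front z x = take (length x) (z # x)" by (simp add: to_front_def)
  moreover have "distinct (z # x)" using False wordsD[OF assms(1)] by simp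
  moreover have "set (take (length x) (z # x)) \<subseteq> insert z (set x)"
    using set_take_subset[of "length x" "z # x"] by simp
  ultimately show ?thesis
    using wordsD[OF assms(1)] assms(2) distinct_take[of "z # x"] by (auto simp: words_def)
qed

text \<open>If \<open>z\<close> occurs in \<open>x\<close>, it is reinserted at the index counting
  the letters before it, which is positive because \<open>z\<close> is not the first. Otherwise the
  shift discards \<open>z\<close> and appends the dropped last letter of \<open>x\<close>
  again.\<close>

lemma shifts_to_front:
  assumes "x \<in> words S m" "x \<noteq> []" "z \<noteq> hd x"
  shows "x \<in> shifts S (to_front z x)"
proof (cases "z \<in> set x")
  case True
  then obtain ps qs where x: "x = ps @ z # qs" by (meson split_list)
  have "ps \<noteq> []" using assms(3) x by auto
  moreover have "to_front z x = z # ps @ qs"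
    using wordsD[OF assms(1)] by (auto simp: to_front_def x)
  ultimately show ?thesis
    unfolding shifts_def by (intro UnI1 image_eqI[of _ _ "length ps"]) (auto simp: x Suc_le_eq)
next
  case False
  obtain t w where x: "x = t @ [w]" using assms(2) by (metis rev_exhaust)
  have "to_front z x = z # t" using False by (simp add: to_front_def x)
  then show ?thesis
    unfolding shifts_def using wordsD[OF assms(1)] False
    by (intro UnI2 image_eqI[of _ _ w]) (auto simp: x)
qed

section \<open>Connectivity after deleting words\<close>

definition shift_rel :: "'a set \<Rightarrow> nat \<Rightarrow> 'a list set \<Rightarrow> 'a list rel" where
  "shift_rel S m X = {(x, y). x \<in> words S m - X \<and> y \<in> words S m - X \<and> y \<in> shifts S x}"

lemma shift_rel_rtrancl_in_words:
  assumes "(x, y) \<in> (shift_rel S m X)\<^sup>*" "x \<in> words S m - X"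
  shows "y \<in> words S m - X"
  using assms by (induction rule: rtrancl_induct) (auto simp: shift_rel_def)

lemma to_front_shift_rel:
  assumes "x \<in> words S m - X" "x \<noteq> []" "z \<in> S" "z \<noteq> hd x" "to_front z x \<notin> X"
  shows "(to_front z x, x) \<in> shift_rel S m X"
  using assms shifts_to_front[of x S m z] to_front_in_words[of x S m z] by (simp add: shift_rel_def)

section \<open>The position of a letter along arcs\<close>

text \<open>An absent letter gets the value \<open>length x\<close>, as if it stood just behind the
  word.\<close>

definition offset :: "'a \<Rightarrow> 'a list \<Rightarrow> nat" where
  "offset a x = length (takeWhile (\<lambda>b. b \<noteq> a) x)"

lemma offset_simps [simp]:
  "offset a [] = 0"
  "offset a (b # x) = (if b = a then 0 else Suc (offset a x))"
  by (auto simp: offset_def)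

lemma offset_append:
  "offset a (x @ y) = (if a \<in> set x then offset a x else length x + offset a y)"
  by (induction x) auto

lemma offset_notin: "a \<notin> set x \<Longrightarrow> offset a x = length x"
  by (induction x) auto

lemma offset_shifts_le:
  assumes "x \<in> words S m" "x \<noteq> []" "hd x \<noteq> a" "y \<in> shifts S x"
  shows "offset a y \<le> offset a x"
proof -
  obtain c t where x: "x = c # t" using assms(2) by (cases x) auto
  have c: "c \<noteq> a" using assms(3) x by simp
  from assms(4) consider (ins) j where "y = take j t @ c # drop j t"
    | (app) w where "y = t @ [w]"
    by (auto simp: shifts_def x)
  then show ?thesis
  proof cases
    case ins
    have "offset a (take j t @ drop j t) = offset a t" by simp
    then show ?thesis using c unfolding ins x offset_append by (auto split: if_splits)
  next
    case app
    then show ?thesis using c by (auto simp: x offset_append offset_notin)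
  qed
qed

text \<open>Rotating the first letter to the end brings an \<open>a\<close> contained in
  \<open>y\<close> one place forward; an absent \<open>a\<close> is appended, so its offset drops
  from \<open>m\<close> to \<open>m - 1\<close>.\<close>

lemma ex_shift_offset_less:
  assumes "y \<in> words S m" "2 \<le> m" "hd y \<noteq> a" "a \<in> S"
  shows "tl y @ [if a \<in> set y then hd y else a] \<in> shifts S y"
    and "offset a (tl y @ [if a \<in> set y then hd y else a]) < offset a y"
proof -
  obtain c t where y: "y = c # t" "t \<noteq> []"
    using assms wordsD(1)[OF assms(1)] by (cases y; cases "tl y") auto
  show "tl y @ [if a \<in> set y then hd y else a] \<in> shifts S y"
  proof (cases "a \<in> set y")
    case True
    then show ?thesis unfolding shifts_def
      by (intro UnI1 image_eqI[of _ _ "length t"]) (use y in \<open>auto simp: Suc_le_eq\<close>)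
  next
    case False
    then show ?thesis using assms(4) by (auto simp: shifts_def)
  qed
  show "offset a (tl y @ [if a \<in> set y then hd y else a]) < offset a y"
    using y assms(3) by (auto simp: offset_append offset_notin)
qed

text \<open>Take a word \<open>x\<close> reachable from \<open>v\<close>, not starting with \<open>a\<close>, in which \<open>a\<close> is as
  close to the front as possible. If \<open>a\<close> is not its second letter, then each of the \<open>card S - 1\<close>
  shifts \<open>y\<close> of \<open>x\<close> is either deleted itself, or has a shift that brings \<open>a\<close> closer to the front and
  hence is deleted. All \<open>y\<close> have the same first letter, which their shifts do not start with,
  so that these deleted words are pairwise distinct.\<close>

lemma reach_word_with_second_letter:
  assumes S: "finite S" and m: "2 \<le> m" and X: "finite X" "card X + 2 \<le> card S"
    and a: "a \<in> S" and v: "v \<in> words S m - X"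
  obtains z y where "(v, z # a # y) \<in> (shift_rel S m X)\<^sup>*"
proof -
  define B where "B = {x. (v, x) \<in> (shift_rel S m X)\<^sup>* \<and> hd x \<noteq> a}"
  have BW: "x \<in> words S m - X" if "x \<in> B" for x
    using that shift_rel_rtrancl_in_words[OF _ v] by (simp add: B_def)
  have ne: "x \<noteq> []" if "x \<in> words S m" for x
    using that m by (auto simp: words_def)
  have step: "y \<in> B" if "x \<in> words S m - X" "(v, x) \<in> (shift_rel S m X)\<^sup>*" "y \<in> shifts S x" "y \<notin> X"
    "hd y \<noteq> a" for x y
  proof -
    have "y \<in> words S m" using that(1,3) shifts_in_words[of x S m y] ne[of x] by blast
    then have "(x, y) \<in> shift_rel S m X" using that by (auto simp: shift_rel_def)
    with that(2) have "(v, y) \<in> (shift_rel S m X)\<^sup>*" by (rule rtrancl_into_rtrancl)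
    then show ?thesis using that(5) by (simp add: B_def)
  qed
  \<comment> \<open>Only a \<open>v\<close> starting with \<open>a\<close> needs a step: one of its
    \<open>card S - 1\<close> shifts survives, as \<open>X\<close> is smaller, and it starts with
    the second letter of \<open>v\<close>, which is not \<open>a\<close>.\<close>
  have "B \<noteq> {}"
  proof (cases "hd v = a")
    case True
    have "\<not> shifts S v \<subseteq> X"
    proof
      assume "shifts S v \<subseteq> X"
      then have "card (shifts S v) \<le> card X" using X card_mono by blast
      then show False using card_shifts[OF S, of v m] v ne X by auto
    qed
    then obtain y where y: "y \<in> shifts S v" "y \<notin> X" by blast
    have "hd y = v ! 1" using hd_shifts y v m by blast
    moreover have "v ! 1 \<noteq> v ! 0"
      using v m by (subst nth_eq_iff_index_eq) (auto simp: words_def)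
    ultimately have "hd y \<noteq> a" using True v ne hd_conv_nth[of v] by auto
    then show ?thesis using step[of v y] v y by auto
  next
    case False
    then show ?thesis by (auto simp: B_def)
  qed
  then obtain x0 where "x0 \<in> B" by blast
  then obtain x where x: "x \<in> B" and min: "\<And>y. y \<in> B \<Longrightarrow> offset a x \<le> offset a y"
    using ex_has_least_nat[of "\<lambda>x. x \<in> B" x0 "offset a"] by blast
  obtain c d t where xc: "x = c # d # t"
    using BW[OF x] m by (cases x; cases "tl x") (auto simp: words_def)
  have xW: "x \<in> words S m" and ca: "c \<noteq> a" and xr: "(v, x) \<in> (shift_rel S m X)\<^sup>*"
    using BW[OF x] x by (auto simp: B_def xc)
  have "d = a"
  proof (rule ccontr)
    assume da: "d \<noteq> a"
    let ?\<psi> = "\<lambda>y. tl y @ [if a \<in> set y then hd y else a]"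
    let ?f = "\<lambda>y. if y \<in> X then y else ?\<psi> y"
    have yW: "y \<in> words S m" "hd y = d" if "y \<in> shifts S x" for y
      using shifts_in_words[OF xW that] hd_shifts[OF xW m that] by (auto simp: xc)
    have tl_y: "tl y \<noteq> []" "hd (tl y) \<noteq> d" "y = d # tl y" if y: "y \<in> shifts S x" for y
    proof -
      obtain e f r where "y = e # f # r"
        using yW(1)[OF y] m by (cases y; cases "tl y") (auto simp: words_def)
      then show "tl y \<noteq> []" "hd (tl y) \<noteq> d" "y = d # tl y"
        using yW[OF y] by (auto simp: words_def)
    qed
    have "?f y \<in> X" if y: "y \<in> shifts S x" for y
    proof (rule ccontr)
      assume "?f y \<notin> X"
      then have yX: "y \<notin> X" "?\<psi> y \<notin> X" by (auto split: if_splits)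
      have yB: "y \<in> B" using step[OF BW[OF x] xr y yX(1)] yW(2)[OF y] da by simp
      have le: "offset a y \<le> offset a x"
        by (rule offset_shifts_le[OF xW _ _ y]) (use ca in \<open>auto simp: xc\<close>)
      have hd_y: "hd y \<noteq> a" using yW[OF y] da by simp
      note \<psi> = ex_shift_offset_less[OF yW(1)[OF y] m hd_y a]
      have "hd (?\<psi> y) = hd (tl y)" using tl_y(1)[OF y] by simp
      \<comment> \<open>This keeps \<open>?\<psi> y\<close> in \<open>B\<close>. A second letter
        \<open>a\<close> would give \<open>y\<close> offset 1, whereas \<open>x\<close>, whose first
        two letters are not \<open>a\<close>, has offset at least 2 and is minimal.\<close>
      have "hd (tl y) \<noteq> a"
      proof
        assume "hd (tl y) = a"
        then obtain r where "y = d # a # r" using tl_y(1,3)[OF y] by (metis list.collapse)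
        then have "offset a y = 1" using da by simp
        then show False using min[OF yB] ca da by (auto simp: xc)
      qed
      then have "?\<psi> y \<in> B"
        using step[of y "?\<psi> y"] \<psi>(1) yX(2) BW[OF yB] yB \<open>hd (?\<psi> y) = hd (tl y)\<close>
        by (auto simp: B_def)
      then show False using min[of "?\<psi> y"] \<psi>(2) le by linarith
    qed
    then have "?f ` shifts S x \<subseteq> X" by blast
    moreover have "inj_on ?f (shifts S x)"
    proof (rule inj_onI)
      fix y y' assume y: "y \<in> shifts S x" and y': "y' \<in> shifts S x" and eq: "?f y = ?f y'"
      have h: "hd (?\<psi> y) \<noteq> d" "hd (?\<psi> y') \<noteq> d" using tl_y(1,2)[OF y] tl_y(1,2)[OF y'] by simp_all
      have "y = y' \<or> tl y = tl y'"
      proof (cases "y \<in> X"; cases "y' \<in> X")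
        assume "y \<in> X" "y' \<notin> X"
        then have "y = ?\<psi> y'" using eq by (simp only: if_True if_False)
        then show ?thesis using h(2) yW(2)[OF y] by metis
      next
        assume "y \<notin> X" "y' \<in> X"
        then have "y' = ?\<psi> y" using eq by (simp only: if_True if_False)
        then show ?thesis using h(1) yW(2)[OF y'] by metis
      qed (use eq in simp_all)
      then show "y = y'" using tl_y(3)[OF y] tl_y(3)[OF y'] by metis
    qed
    ultimately have "card (shifts S x) \<le> card X"
      using X(1) by (intro card_inj_on_le[of ?f])
    then show False using card_shifts[OF S xW] X by (auto simp: xc)
  qed
  then show ?thesis using that[of c t] xr xc by simp
qed

section \<open>Reduction to shorter words over fewer letters\<close>

text \<open>The first arc puts \<open>a\<close> behind \<open>z\<close>; the second removes
  \<open>z\<close> from the front and continues as the shift of \<open>y\<close> does, with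
  \<open>a\<close> kept ahead. Both ends survive because no word of \<open>X\<close> starts with
  \<open>a\<close>, so only the middle word has to be assumed outside \<open>X\<close>.\<close>

lemma lift_shift:
  assumes "y \<in> words (S - {a}) m" "y \<noteq> []" "y' \<in> shifts (S - {a}) y"
    and a: "a \<in> S" "\<And>x. a # x \<notin> X" and "hd y # a # tl y \<notin> X"
  shows "(a # y, a # y') \<in> (shift_rel S (Suc m) X)\<^sup>*"
proof -
  obtain z t where y: "y = z # t" using assms(2) by (cases y) auto
  have y'W: "y' \<in> words (S - {a}) m" using shifts_in_words assms by blast
  have aW: "a # y \<in> words S (Suc m) - X" "a # y' \<in> words S (Suc m) - X"
    using assms(1) y'W a by (auto simp: Cons_in_words_iff)
  have zW: "z # a # t \<in> words S (Suc m) - X"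
    using aW(1) assms(6) by (auto simp: y words_def)
  have "z # a # t \<in> shifts S (a # y)"
    unfolding shifts_def by (intro UnI1 image_eqI[of _ _ 1]) (auto simp: y)
  moreover have "a # y' \<in> shifts S (z # a # t)"
    using assms(3) unfolding shifts_def
  proof
    assume "y' \<in> (\<lambda>j. take j (tl y) @ hd y # drop j (tl y)) ` {1..<length y}"
    then obtain j where "j \<in> {1..<length y}" "y' = take j t @ z # drop j t" by (auto simp: y)
    then have "a # y' \<in> (\<lambda>j. take j (tl (z # a # t)) @ hd (z # a # t) # drop j (tl (z # a # t)))
        ` {1..<length (z # a # t)}"
      by (intro image_eqI[of _ _ "Suc j"]) (auto simp: y)
    then show "a # y' \<in> (\<lambda>j. take j (tl (z # a # t)) @ hd (z # a # t) # drop j (tl (z # a # t)))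
        ` {1..<length (z # a # t)} \<union> (\<lambda>w. tl (z # a # t) @ [w]) ` (S - set (z # a # t))" by blast
  next
    assume "y' \<in> (\<lambda>w. tl y @ [w]) ` (S - {a} - set y)"
    then show "a # y' \<in> (\<lambda>j. take j (tl (z # a # t)) @ hd (z # a # t) # drop j (tl (z # a # t)))
        ` {1..<length (z # a # t)} \<union> (\<lambda>w. tl (z # a # t) @ [w]) ` (S - set (z # a # t))"
      by (auto simp: y)
  qed
  ultimately have "(a # y, z # a # t) \<in> shift_rel S (Suc m) X"
    "(z # a # t, a # y') \<in> shift_rel S (Suc m) X"
    using aW zW by (auto simp: shift_rel_def)
  then show ?thesis by (meson r_into_rtrancl rtrancl_into_rtrancl)
qed

text \<open>At most \<open>card S - 2\<close> letters occur first in \<open>X\<close>, so two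
  letters \<open>a\<close> and \<open>b\<close> are free. If all words of \<open>X\<close> have
  \<open>a\<close> second, none has \<open>b\<close> second; otherwise those with \<open>a\<close>
  second are fewer than \<open>card X\<close>. The gain of one pays for the letter lost in passing
  to \<open>S - {a}\<close>.\<close>

lemma ex_avoided_letter:
  assumes S: "finite S" "3 \<le> card S" and X: "finite X" "card X + 2 \<le> card S"
  obtains a where "a \<in> S" "\<And>x. a # x \<notin> X"
    "card {x \<in> X. hd (tl x) = a} + 3 \<le> card S"
proof -
  have "card S \<le> card (S - hd ` X) + card (hd ` X)"
    by (rule order_trans[OF card_mono card_Un_le]) (use S X in auto)
  moreover have "card (hd ` X) \<le> card X" by (rule card_image_le[OF X(1)])
  ultimately have "2 \<le> card (S - hd ` X)" using X(2) by linarith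
  then obtain T where "T \<subseteq> S - hd ` X" "card T = 2" by (metis obtain_subset_with_card_n)
  then obtain a b where ab: "a \<in> S - hd ` X" "b \<in> S - hd ` X" "a \<noteq> b"
    by (auto simp: card_2_iff)
  have avoid: "c # x \<notin> X" if "c \<in> S - hd ` X" for c x
    using that by force
  show ?thesis
  proof (cases "\<forall>x\<in>X. hd (tl x) = a")
    case True
    then have "{x \<in> X. hd (tl x) = b} = {}" using ab(3) by auto
    then have "card {x \<in> X. hd (tl x) = b} + 3 \<le> card S" using S by (simp only: card.empty)
    then show ?thesis using that[of b] ab avoid by blast
  next
    case False
    then have "{x \<in> X. hd (tl x) = a} \<subset> X" by blast
    then have "card {x \<in> X. hd (tl x) = a} < card X" using X(1) psubset_card_mono by blast
    then show ?thesis using that[of a] ab avoid X(2) by fastforce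
  qed
qed

text \<open>\<open>S\<close> and \<open>X\<close> vary in the induction: the step passes to
  \<open>S - {a}\<close> and to the set \<open>Y\<close> of words with blocked lifts, and
  \<open>card Y + 3 \<le> card S\<close> restores the bound on the deleted set.\<close>

theorem shift_rel_connected:
  assumes "1 \<le> m" "finite S" "m < card S" "finite X" "card X + 2 \<le> card S"
    and "v \<in> words S m - X" "u \<in> words S m - X"
  shows "(v, u) \<in> (shift_rel S m X)\<^sup>*"
  using assms
proof (induction m arbitrary: S X u v rule: nat_induct_at_least)
  case base
  obtain c d where cd: "v = [c]" "u = [d]"
    using base by (auto simp: words_def length_Suc_conv)
  show ?case
  proof (cases "c = d")
    case False
    then have "u \<in> shifts S v" using base by (auto simp: cd shifts_def words_def)
    then show ?thesis using base by (auto simp: shift_rel_def)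
  qed (simp add: cd)
next
  case (Suc m)
  note S = \<open>finite S\<close> and X = \<open>finite X\<close> \<open>card X + 2 \<le> card S\<close>
  note v = \<open>v \<in> words S (Suc m) - X\<close> and u = \<open>u \<in> words S (Suc m) - X\<close>
  let ?R = "shift_rel S (Suc m) X"
  have "3 \<le> card S" using Suc by linarith
  from ex_avoided_letter[OF S this X] obtain a
    where a: "a \<in> S" "\<And>x. a # x \<notin> X" and
      less: "card {x \<in> X. hd (tl x) = a} + 3 \<le> card S" by metis
  \<comment> \<open>The words \<open>z # t\<close> whose midpoint \<open>z # a # t\<close> is
    deleted: the only obstruction to lifting an arc that leaves \<open>z # t\<close>.\<close>
  define Y where "Y = {z # t | z t. z # a # t \<in> X}"
  have cardS: "card (S - {a}) = card S - 1" using a by (simp add: card_Diff_singleton)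
  have YX: "Y \<subseteq> (\<lambda>x. hd x # tl (tl x)) ` {x \<in> X. hd (tl x) = a}"
    by (force simp: Y_def)
  then have finY: "finite Y" using X finite_subset by fastforce
  have "card Y \<le> card {x \<in> X. hd (tl x) = a}"
    using X by (intro surj_card_le[OF _ YX]) simp
  then have cardY: "card Y + 3 \<le> card S" using less by linarith
  have ne: "y \<noteq> []" if "y \<in> words T m" for y and T :: "'a set"
    using that \<open>1 \<le> m\<close> by (auto simp: words_def)
  \<comment> \<open>Only the source has to avoid \<open>Y\<close>; that the target may lie in
    \<open>Y\<close> is used at the end of the proof.\<close>
  have lift: "(a # y, a # y') \<in> ?R\<^sup>*"
    if "y \<in> words (S - {a}) m - Y" "y' \<in> shifts (S - {a}) y" for y y'
  proof (rule lift_shift)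
    show "hd y # a # tl y \<notin> X" using that ne[of y] by (force simp: Y_def)
  qed (use that a ne in auto)
  have core: "(a # y, a # y') \<in> ?R\<^sup>*"
    if "y \<in> words (S - {a}) m - Y" "y' \<in> words (S - {a}) m - Y" for y y'
  proof -
    have "(y, y') \<in> (shift_rel (S - {a}) m Y)\<^sup>*"
      by (rule Suc.IH) (use that S finY cardS cardY Suc.prems in auto)
    then show ?thesis
    proof (induction rule: rtrancl_induct)
      case (step y1 y2)
      then have "(a # y1, a # y2) \<in> ?R\<^sup>*" using lift by (auto simp: shift_rel_def)
      then show ?case using step.IH by (rule rtrancl_trans[rotated])
    qed simp
  qed
  have "2 \<le> Suc m" using Suc by simp
  from reach_word_with_second_letter[OF S this X a(1) v] obtain z t
    where vr: "(v, z # a # t) \<in> ?R\<^sup>*" by metis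
  have zW: "z # a # t \<in> words S (Suc m) - X"
    using shift_rel_rtrancl_in_words[OF vr v] .
  have "a # z # t \<in> shifts S (z # a # t)"
    unfolding shifts_def by (intro UnI1 image_eqI[of _ _ 1]) auto
  moreover have azW: "a # z # t \<in> words S (Suc m) - X"
    using zW a by (auto simp: words_def)
  ultimately have "(z # a # t, a # z # t) \<in> ?R"
    using zW by (auto simp: shift_rel_def)
  with vr have vr': "(v, a # z # t) \<in> ?R\<^sup>*" by simp
  \<comment> \<open>The path from \<open>v\<close> went through \<open>z # a # t\<close>, so this
    word is not deleted. Thus \<open>v\<close> enters the mutually reachable words of
    \<open>core\<close>, not merely some word starting with \<open>a\<close>.\<close>
  have "z # t \<notin> Y" using zW by (auto simp: Y_def)
  then have zt: "z # t \<in> words (S - {a}) m - Y"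
    using azW by (auto simp: Cons_in_words_iff)
  \<comment> \<open>Unless \<open>u\<close> starts with \<open>a\<close>, it is entered from the
    word with \<open>a\<close> moved to the front, which survives since no word of \<open>X\<close>
    starts with \<open>a\<close>. Here \<open>y\<close> may still lie in \<open>Y\<close>.\<close>
  obtain y where y: "y \<in> words (S - {a}) m" and ur: "(a # y, u) \<in> ?R\<^sup>*"
  proof (cases "hd u = a")
    case True
    then show ?thesis using that[of "tl u"] u
      by (elim DiffE words_Suc_cases) auto
  next
    case False
    have une: "u \<noteq> []" using u by (auto simp: words_def)
    have h: "hd (to_front a u) = a" using hd_to_front[OF une] .
    moreover have W: "to_front a u \<in> words S (Suc m)" using to_front_in_words[OF _ a(1), of u] u by simp
    ultimately obtain y where y: "to_front a u = a # y" "y \<in> words (S - {a}) m"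
      by (elim words_Suc_cases) auto
    have "(to_front a u, u) \<in> ?R"
      by (rule to_front_shift_rel) (use u une a False y in auto)
    then show ?thesis using that[of y] y by auto
  qed
  obtain y' where y': "y' \<in> words (S - {a}) m - Y" "(a # y', a # y) \<in> ?R\<^sup>*"
  proof (cases "y \<in> Y")
    case True
    \<comment> \<open>Each of the at least \<open>card S - 2\<close> letters other than
      \<open>a\<close> and \<open>hd y\<close> gives a different in-neighbour of \<open>y\<close>,
      and \<open>Y\<close> has at most \<open>card S - 3\<close> words, so one in-neighbour lies
      outside \<open>Y\<close>.\<close>
    let ?Z = "S - {a} - {hd y}"
    have inj: "inj_on (\<lambda>z. to_front z y) ?Z"
      using hd_to_front[OF ne[OF y]] by (metis inj_onI)
    have "card ?Z \<ge> card S - 2"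
      using cardS diff_card_le_card_Diff[of "{hd y}" "S - {a}"] by simp
    then have "card Y < card ((\<lambda>z. to_front z y) ` ?Z)"
      using card_image[OF inj] cardY by linarith
    then have "\<not> (\<lambda>z. to_front z y) ` ?Z \<subseteq> Y" using card_mono[OF finY] by (meson not_le)
    then obtain z where z: "z \<in> ?Z" "to_front z y \<notin> Y" by blast
    have "to_front z y \<in> words (S - {a}) m - Y" "y \<in> shifts (S - {a}) (to_front z y)"
      using z to_front_in_words[OF y, of z] shifts_to_front[OF y ne[OF y], of z] by auto
    then show ?thesis using that[of "to_front z y"] lift[of "to_front z y" y] by simp
  qed (use that y in auto)
  show ?case using vr' core[OF zt y'(1)] y'(2) ur by (meson rtrancl_trans)
qed

section \<open>Cosets as words\<close>

text \<open>Inverses occur because the product is reversed: with \<open>m = n - k\<close>, the left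
  coset of \<open>g\<close> consists of all \<open>h \<circ> g\<close> with \<open>h\<close> fixing
  \<open>{1..m}\<close> pointwise, and exactly these have inverses agreeing with that of
  \<open>g\<close> on \<open>{1..m}\<close>.\<close>

definition prefix_word :: "nat \<Rightarrow> (nat \<Rightarrow> nat) \<Rightarrow> nat list" where
  "prefix_word m p = map (Hilbert_Choice.inv p) [1..<Suc m]"

definition word_coset :: "nat \<Rightarrow> nat list \<Rightarrow> (nat \<Rightarrow> nat) set" where
  "word_coset n x = {p. p permutes {1..n} \<and> prefix_word (length x) p = x}"

lemma length_prefix_word [simp]: "length (prefix_word m p) = m"
  by (simp add: prefix_word_def)

lemma nth_prefix_word: "i < m \<Longrightarrow> prefix_word m p ! i = Hilbert_Choice.inv p (Suc i)"
  by (simp add: prefix_word_def del: upt_Suc)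

lemma prefix_word_Suc: "prefix_word (Suc m) p = prefix_word m p @ [Hilbert_Choice.inv p (Suc m)]"
  by (simp add: prefix_word_def)

lemma prefix_word_in_words:
  assumes "p permutes {1..n}" "m \<le> n"
  shows "prefix_word m p \<in> words {1..n} m"
proof -
  have p': "Hilbert_Choice.inv p permutes {1..n}" by (rule permutes_inv[OF assms(1)])
  have "distinct (prefix_word m p)"
    unfolding prefix_word_def distinct_map using permutes_inj_on[OF p'] by simp
  moreover have "set (prefix_word m p) \<subseteq> {1..n}"
    using permutes_in_image[OF p'] assms(2) by (fastforce simp: prefix_word_def)
  ultimately show ?thesis by (simp add: words_def)
qed

text \<open>Complete \<open>x\<close> by the missing letters to a list \<open>L\<close> of all of
  \<open>{1..n}\<close>. Reading \<open>L\<close> by one-based positions gives \<open>q\<close>; its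
  inverse is the permutation sought, since \<open>prefix_word\<close> inverts again.\<close>

lemma ex_permutes_prefix_word:
  assumes "x \<in> words {1..n} m"
  obtains p where "p permutes {1..n}" "prefix_word m p = x"
proof -
  note xD = wordsD[OF assms]
  obtain r where r: "set r = {1..n} - set x" "distinct r"
    using finite_distinct_list[of "{1..n} - set x"] by auto
  define L where "L = x @ r"
  have L: "distinct L" "set L = {1..n}" using r xD by (auto simp: L_def)
  have len: "length L = n" using distinct_card[OF L(1)] L(2) by simp
  define q where "q i = (if i \<in> {1..n} then L ! (i - 1) else i)" for i
  have "bij_betw (\<lambda>i. i - 1) {1..n} {..<n}"
    by (rule bij_betw_byWitness[where f' = Suc]) auto
  then have "bij_betw (\<lambda>i. L ! (i - 1)) {1..n} {1..n}"
    using bij_betw_trans[OF _ bij_betw_nth[OF L(1) refl refl]] by (simp add: len L(2) comp_def)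
  then have "bij_betw q {1..n} {1..n}"
    by (rule bij_betw_cong[THEN iffD1, rotated]) (simp add: q_def)
  then have q: "q permutes {1..n}"
    by (rule bij_imp_permutes) (auto simp: q_def)
  have "m \<le> n" using len xD(1) by (simp add: L_def)
  have "prefix_word m (Hilbert_Choice.inv q) = x"
  proof (rule nth_equalityI)
    fix i assume "i < length (prefix_word m (Hilbert_Choice.inv q))"
    then have i: "i < m" by simp
    then have "prefix_word m (Hilbert_Choice.inv q) ! i = q (Suc i)"
      using permutes_inv_inv[OF q] by (simp add: nth_prefix_word)
    also have "\<dots> = x ! i" using i \<open>m \<le> n\<close> xD(1) by (simp add: q_def L_def nth_append)
    finally show "prefix_word m (Hilbert_Choice.inv q) ! i = x ! i" .
  qed (simp add: xD)
  then show ?thesis using that permutes_inv[OF q] by blast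
qed

text \<open>These cosets are never empty, and any member recovers the word.\<close>

lemma inj_on_word_coset: "inj_on (word_coset n) (words {1..n} m)"
proof (rule inj_onI)
  fix x y assume xy: "x \<in> words {1..n} m" "y \<in> words {1..n} m" "word_coset n x = word_coset n y"
  obtain p where p: "p permutes {1..n}" "prefix_word m p = x" using ex_permutes_prefix_word[OF xy(1)] .
  then have "p \<in> word_coset n x" using wordsD(1)[OF xy(1)] by (simp add: word_coset_def)
  then have "p \<in> word_coset n y" using xy(3) by simp
  then show "x = y" using p(2) wordsD(1)[OF xy(2)] by (simp add: word_coset_def)
qed

section \<open>Prefix cycles acting on words\<close>

lemma inv_prefix_cycle:
  assumes "2 \<le> j" "1 \<le> i"
  shows "Hilbert_Choice.inv (prefix_cycle j) i = (if i < j then Suc i else if i = j then 1 else i)"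
  unfolding permutes_inv_eq[OF prefix_cycle_permutes[OF assms(1) order_refl]]
  using assms by (auto simp: prefix_cycle_def)

lemma inv_prefix_cycle_comp:
  assumes "p permutes {1..n}" "2 \<le> j" "j \<le> n" "1 \<le> i"
  shows "Hilbert_Choice.inv (prefix_cycle j \<circ> p) i
    = Hilbert_Choice.inv p (if i < j then Suc i else if i = j then 1 else i)"
  using assms permutes_bij[OF assms(1)] permutes_bij[OF prefix_cycle_permutes[OF assms(2,3)]]
  by (simp add: o_inv_distrib inv_prefix_cycle)

text \<open>For \<open>j < m\<close> the first letter moves to index \<open>j\<close> and stays
  inside the window of \<open>m\<close> letters, so nothing enters from behind the window.\<close>

lemma prefix_word_cycle_insert:
  assumes "p permutes {1..n}" "1 \<le> j" "j < m" "m \<le> n"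
  shows "prefix_word m (prefix_cycle (Suc j) \<circ> p)
    = take j (tl (prefix_word m p)) @ hd (prefix_word m p) # drop j (tl (prefix_word m p))"
proof (rule nth_equalityI)
  fix i assume "i < length (prefix_word m (prefix_cycle (Suc j) \<circ> p))"
  then have i: "i < m" by simp
  have "hd (prefix_word m p) = Hilbert_Choice.inv p 1"
    using assms nth_prefix_word[of 0 m p] by (subst hd_conv_nth) (auto simp flip: length_greater_0_conv)
  then show "prefix_word m (prefix_cycle (Suc j) \<circ> p) ! i
    = (take j (tl (prefix_word m p)) @ hd (prefix_word m p) # drop j (tl (prefix_word m p))) ! i"
    using i assms by (auto simp: nth_prefix_word inv_prefix_cycle_comp nth_append nth_tl nth_Cons'
        min_def)
qed (use assms in simp)

text \<open>The first letter is carried to position \<open>m + 1\<close>, just outside the window,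
  and the letter that stood there enters.\<close>

lemma prefix_word_cycle_append:
  assumes "p permutes {1..n}" "1 \<le> m" "m < n"
  shows "prefix_word m (prefix_cycle (Suc m) \<circ> p)
    = tl (prefix_word m p) @ [Hilbert_Choice.inv p (Suc m)]"
proof (rule nth_equalityI)
  fix i assume "i < length (prefix_word m (prefix_cycle (Suc m) \<circ> p))"
  then have i: "i < m" by simp
  then show "prefix_word m (prefix_cycle (Suc m) \<circ> p) ! i
    = (tl (prefix_word m p) @ [Hilbert_Choice.inv p (Suc m)]) ! i"
    using assms by (cases "i = m - 1")
      (auto simp: nth_prefix_word inv_prefix_cycle_comp nth_append nth_tl)
qed (use assms in simp)

text \<open>\<open>p\<close> ranges over a whole coset. For \<open>j \<le> m\<close> the outcome
  depends on \<open>x\<close> alone; for \<open>j = m + 1\<close> the entering letter is, as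
  \<open>p\<close> varies, any letter outside \<open>x\<close>.\<close>

lemma prefix_cycle_arc_iff_shift:
  assumes m: "1 \<le> m" "m < n" and x: "x \<in> words {1..n} m"
  shows "(\<exists>j\<in>{2..Suc m}. \<exists>p. p permutes {1..n} \<and> prefix_word m p = x
      \<and> prefix_word m (prefix_cycle j \<circ> p) = y) \<longleftrightarrow> y \<in> shifts {1..n} x"
    (is "?L \<longleftrightarrow> ?R")
proof
  assume ?L
  then obtain j p where j: "j \<in> {2..Suc m}" and p: "p permutes {1..n}" "prefix_word m p = x"
    and y: "prefix_word m (prefix_cycle j \<circ> p) = y" by blast
  show ?R
  proof (cases "j = Suc m")
    case True
    have "prefix_word (Suc m) p \<in> words {1..n} (Suc m)"
      by (rule prefix_word_in_words) (use p m in auto)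
    then have "Hilbert_Choice.inv p (Suc m) \<in> {1..n} - set x"
      by (auto simp: prefix_word_Suc words_def p)
    moreover have "y = tl x @ [Hilbert_Choice.inv p (Suc m)]"
      using prefix_word_cycle_append[OF p(1) m] y True p(2) by simp
    ultimately show ?thesis by (simp add: shifts_def)
  next
    case False
    then obtain i where i: "j = Suc i" "1 \<le> i" "i < m" using j by (cases j) auto
    then have "y = take i (tl x) @ hd x # drop i (tl x)"
      using prefix_word_cycle_insert[OF p(1) i(2,3)] y p(2) m by simp
    then show ?thesis using i wordsD(1)[OF x] by (simp add: shifts_def)
  qed
next
  assume ?R
  then consider (ins) i where "i \<in> {1..<m}" "y = take i (tl x) @ hd x # drop i (tl x)"
    | (app) w where "w \<in> {1..n} - set x" "y = tl x @ [w]"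
    using wordsD(1)[OF x] by (auto simp: shifts_def)
  then show ?L
  proof cases
    case ins
    obtain p where p: "p permutes {1..n}" "prefix_word m p = x" using ex_permutes_prefix_word[OF x] .
    have "prefix_word m (prefix_cycle (Suc i) \<circ> p) = y"
      using prefix_word_cycle_insert[OF p(1), of i m] ins p(2) m by simp
    then show ?thesis using p ins by (intro bexI[of _ "Suc i"] exI[of _ p]) auto
  next
    case app
    have "x @ [w] \<in> words {1..n} (Suc m)" using app wordsD[OF x] by (auto simp: words_def)
    then obtain p where p: "p permutes {1..n}" "prefix_word (Suc m) p = x @ [w]"
      by (rule ex_permutes_prefix_word)
    then have "prefix_word m p = x" "Hilbert_Choice.inv p (Suc m) = w"
      by (simp_all add: prefix_word_Suc)
    moreover from this have "prefix_word m (prefix_cycle (Suc m) \<circ> p) = y"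
      using prefix_word_cycle_append[OF p(1) m] app by simp
    ultimately show ?thesis using p m by (intro bexI[of _ "Suc m"] exI[of _ p]) auto
  qed
qed

section \<open>Vertices and arcs in terms of words\<close>

lemma carrier_right_sym_group: "carrier (right_sym_group n) = {p. p permutes {1..n}}"
  by (simp add: right_sym_group_def sym_group_def)

lemma mult_right_sym_group: "p \<otimes>\<^bsub>right_sym_group n\<^esub> q = q \<circ> p"
  by (simp add: right_sym_group_def)

lemma l_coset_prefix_fixing:
  assumes g: "g permutes {1..n}"
  shows "g <#\<^bsub>right_sym_group n\<^esub> prefix_fixing n k = word_coset n (prefix_word (n - k) g)"
proof (intro equalityI subsetI)
  fix p assume "p \<in> g <#\<^bsub>right_sym_group n\<^esub> prefix_fixing n k"
  then obtain h where h: "h permutes {1..n}" "\<forall>i\<in>{1..n - k}. h i = i" and p: "p = h \<circ> g"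
    by (auto simp: l_coset_def prefix_fixing_def carrier_right_sym_group mult_right_sym_group)
  have "Hilbert_Choice.inv p i = Hilbert_Choice.inv g i" if "i \<in> {1..n - k}" for i
  proof -
    have "Hilbert_Choice.inv h i = i" using h that permutes_inv_eq[OF h(1)] by blast
    then show ?thesis
      unfolding p using permutes_bij[OF h(1)] permutes_bij[OF g] by (simp add: o_inv_distrib)
  qed
  then have "prefix_word (n - k) p = prefix_word (n - k) g"
    by (intro nth_equalityI) (auto simp: nth_prefix_word)
  moreover have "p permutes {1..n}" unfolding p by (rule permutes_compose[OF g h(1)])
  ultimately show "p \<in> word_coset n (prefix_word (n - k) g)" by (simp add: word_coset_def)
next
  fix p assume "p \<in> word_coset n (prefix_word (n - k) g)"
  then have p: "p permutes {1..n}" "prefix_word (n - k) p = prefix_word (n - k) g"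
    by (simp_all add: word_coset_def)
  let ?h = "p \<circ> Hilbert_Choice.inv g"
  have "?h i = i" if "i \<in> {1..n - k}" for i
  proof -
    have "Hilbert_Choice.inv p i = Hilbert_Choice.inv g i"
      using p(2) that by (auto simp: prefix_word_def simp del: upt_Suc)
    then show ?thesis using permutes_inverses(1)[OF p(1)] by (metis comp_apply)
  qed
  moreover have "?h permutes {1..n}" by (rule permutes_compose[OF permutes_inv[OF g] p(1)])
  moreover have "p = ?h \<circ> g" using permutes_inv_o(2)[OF g] by (simp add: comp_assoc)
  ultimately show "p \<in> g <#\<^bsub>right_sym_group n\<^esub> prefix_fixing n k"
    by (auto simp: l_coset_def prefix_fixing_def carrier_right_sym_group mult_right_sym_group)
qed

lemma image_prefix_word_permutes:
  assumes "m \<le> n"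
  shows "prefix_word m ` {p. p permutes {1..n}} = words {1..n} m"
proof (intro equalityI subsetI)
  fix x assume "x \<in> words {1..n} m"
  then obtain p where "p permutes {1..n}" "prefix_word m p = x" by (rule ex_permutes_prefix_word)
  then show "x \<in> prefix_word m ` {p. p permutes {1..n}}" by blast
qed (use prefix_word_in_words[OF _ assms] in auto)

lemma verts_cycle_prefix_digraph:
  "verts (cycle_prefix_digraph n k) = word_coset n ` words {1..n} (n - k)"
proof -
  have "verts (cycle_prefix_digraph n k)
      = (\<lambda>g. g <#\<^bsub>right_sym_group n\<^esub> prefix_fixing n k) ` {p. p permutes {1..n}}"
    by (auto simp: cycle_prefix_digraph_def cayley_coset_digraph_def LCOSETS_def
        carrier_right_sym_group)
  also have "\<dots> = (\<lambda>g. word_coset n (prefix_word (n - k) g)) ` {p. p permutes {1..n}}"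
    by (intro image_cong) (auto simp: l_coset_prefix_fixing)
  also have "\<dots> = word_coset n ` words {1..n} (n - k)"
    unfolding image_prefix_word_permutes[OF diff_le_self, symmetric] image_image ..
  finally show ?thesis .
qed

text \<open>The intersection is nonempty iff some \<open>p\<close> in the coset of \<open>g\<close>
  has \<open>prefix_cycle j \<circ> p\<close> in that of \<open>g'\<close>;
  \<open>prefix_cycle_arc_iff_shift\<close> turns this into a shift of words.\<close>

lemma arcs_cycle_prefix_digraph:
  assumes "1 \<le> k" "k < n"
  shows "arcs (cycle_prefix_digraph n k)
    = {(word_coset n x, word_coset n y) | x y. x \<in> words {1..n} (n - k) \<and> y \<in> shifts {1..n} x}"
proof -
  let ?G = "right_sym_group n" and ?H = "prefix_fixing n k"
  define m where "m = n - k"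
  have m: "1 \<le> m" "m < n" using assms by (auto simp: m_def)
  have coset: "g <#\<^bsub>?G\<^esub> ?H = word_coset n (prefix_word m g)" if "g permutes {1..n}" for g
    using l_coset_prefix_fixing[OF that] by (simp add: m_def)
  have step: "(\<exists>s\<in>prefix_cycle ` {2..n - k + 1}. ((g <#\<^bsub>?G\<^esub> ?H) #>\<^bsub>?G\<^esub> s) \<inter> (g' <#\<^bsub>?G\<^esub> ?H) \<noteq> {})
      \<longleftrightarrow> prefix_word m g' \<in> shifts {1..n} (prefix_word m g)"
    if g: "g permutes {1..n}" "g' permutes {1..n}" for g g'
  proof -
    have "((g <#\<^bsub>?G\<^esub> ?H) #>\<^bsub>?G\<^esub> prefix_cycle j) \<inter> (g' <#\<^bsub>?G\<^esub> ?H) \<noteq> {} \<longleftrightarrow>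
      (\<exists>p. p permutes {1..n} \<and> prefix_word m p = prefix_word m g
        \<and> prefix_word m (prefix_cycle j \<circ> p) = prefix_word m g')" if j: "j \<in> {2..Suc m}" for j
    proof -
      have "prefix_cycle j permutes {1..n}" using j m by (intro prefix_cycle_permutes) auto
      then have "prefix_cycle j \<circ> p permutes {1..n}" if "p permutes {1..n}" for p
        using that permutes_compose by blast
      then show ?thesis
        unfolding coset[OF g(1)] coset[OF g(2)] r_coset_def mult_right_sym_group word_coset_def
        by auto
    qed
    moreover have "n - k + 1 = Suc m" by (simp add: m_def)
    ultimately show ?thesis
      using prefix_cycle_arc_iff_shift[OF m prefix_word_in_words[OF g(1)]] m by auto
  qed
  have "arcs (cycle_prefix_digraph n k) = {(g <#\<^bsub>?G\<^esub> ?H, g' <#\<^bsub>?G\<^esub> ?H) | g g'.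
      g permutes {1..n} \<and> g' permutes {1..n} \<and>
      (\<exists>s\<in>prefix_cycle ` {2..n - k + 1}. ((g <#\<^bsub>?G\<^esub> ?H) #>\<^bsub>?G\<^esub> s) \<inter> (g' <#\<^bsub>?G\<^esub> ?H) \<noteq> {})}"
    by (simp add: cycle_prefix_digraph_def cayley_coset_digraph_def carrier_right_sym_group)
  also have "\<dots> = {(word_coset n (prefix_word m g), word_coset n (prefix_word m g')) | g g'.
      g permutes {1..n} \<and> g' permutes {1..n} \<and> prefix_word m g' \<in> shifts {1..n} (prefix_word m g)}"
    (is "?A = ?B")
  proof (intro equalityI subsetI)
    fix e assume "e \<in> ?A"
    then obtain g g' where g: "g permutes {1..n}" "g' permutes {1..n}"
      and e: "e = (g <#\<^bsub>?G\<^esub> ?H, g' <#\<^bsub>?G\<^esub> ?H)"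
      and s: "\<exists>s\<in>prefix_cycle ` {2..n - k + 1}. ((g <#\<^bsub>?G\<^esub> ?H) #>\<^bsub>?G\<^esub> s) \<inter> (g' <#\<^bsub>?G\<^esub> ?H) \<noteq> {}"
      by blast
    show "e \<in> ?B"
      unfolding mem_Collect_eq using g s[unfolded step[OF g]] e[unfolded coset[OF g(1)] coset[OF g(2)]]
      by (intro exI[of _ g] exI[of _ g'] conjI)
  next
    fix e assume "e \<in> ?B"
    then obtain g g' where g: "g permutes {1..n}" "g' permutes {1..n}"
      and e: "e = (word_coset n (prefix_word m g), word_coset n (prefix_word m g'))"
      and s: "prefix_word m g' \<in> shifts {1..n} (prefix_word m g)"
      by blast
    have e': "e = (g <#\<^bsub>?G\<^esub> ?H, g' <#\<^bsub>?G\<^esub> ?H)"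
      using e coset[OF g(1)] coset[OF g(2)] by simp
    show "e \<in> ?A"
      unfolding mem_Collect_eq using g s[folded step[OF g]] e'
      by (intro exI[of _ g] exI[of _ g'] conjI)
  qed
  also have "\<dots> = {(word_coset n x, word_coset n y) | x y. x \<in> words {1..n} m \<and> y \<in> shifts {1..n} x}"
    (is "_ = ?C")
  proof (intro equalityI subsetI)
    fix e assume "e \<in> ?C"
    then obtain x y where e: "e = (word_coset n x, word_coset n y)"
      and x: "x \<in> words {1..n} m" and y: "y \<in> shifts {1..n} x" by blast
    have "x \<noteq> []" using wordsD(1)[OF x] m by auto
    from shifts_in_words[OF x y this] have y': "y \<in> words {1..n} m" .
    obtain g where "g permutes {1..n}" "prefix_word m g = x" using ex_permutes_prefix_word[OF x] .
    moreover obtain g' where "g' permutes {1..n}" "prefix_word m g' = y"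
      using ex_permutes_prefix_word[OF y'] .
    ultimately show "e \<in> ?B" using e y by blast
  next
    fix e assume "e \<in> ?B"
    then obtain g g' where "g permutes {1..n}"
      and "e = (word_coset n (prefix_word m g), word_coset n (prefix_word m g'))"
      and "prefix_word m g' \<in> shifts {1..n} (prefix_word m g)"
      by blast
    then show "e \<in> ?C" using prefix_word_in_words[of g n m] m by auto
  qed
  finally show ?thesis by (simp add: m_def)
qed

lemma tail_head_cycle_prefix_digraph [simp]:
  "tail (cycle_prefix_digraph n k) = fst" "head (cycle_prefix_digraph n k) = snd"
  by (simp_all add: cycle_prefix_digraph_def cayley_coset_digraph_def)

lemma dominates_cycle_prefix_digraph_iff:
  assumes k: "1 \<le> k" "k < n" and x: "x \<in> words {1..n} (n - k)" and y: "y \<in> words {1..n} (n - k)"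
  shows "word_coset n x \<rightarrow>\<^bsub>cycle_prefix_digraph n k\<^esub> word_coset n y \<longleftrightarrow> y \<in> shifts {1..n} x"
proof
  assume "word_coset n x \<rightarrow>\<^bsub>cycle_prefix_digraph n k\<^esub> word_coset n y"
  then have "(word_coset n x, word_coset n y) \<in> arcs (cycle_prefix_digraph n k)"
    by (auto simp: arcs_ends_def arc_to_ends_def)
  then obtain x' y' where x': "x' \<in> words {1..n} (n - k)" "word_coset n x = word_coset n x'"
    and y': "y' \<in> shifts {1..n} x'" "word_coset n y = word_coset n y'"
    unfolding arcs_cycle_prefix_digraph[OF k] by blast
  have "x' \<noteq> []" using wordsD(1)[OF x'(1)] k by auto
  then have "y' \<in> words {1..n} (n - k)" by (rule shifts_in_words[OF x'(1) y'(1)])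
  then have "x = x'" "y = y'" using x y x' y' inj_on_word_coset by (metis inj_on_def)+
  then show "y \<in> shifts {1..n} x" using y'(1) by simp
next
  assume "y \<in> shifts {1..n} x"
  then have "(word_coset n x, word_coset n y) \<in> arcs (cycle_prefix_digraph n k)"
    unfolding arcs_cycle_prefix_digraph[OF k] using x by blast
  then show "word_coset n x \<rightarrow>\<^bsub>cycle_prefix_digraph n k\<^esub> word_coset n y"
    by (force simp: arcs_ends_def arc_to_ends_def)
qed

section \<open>Degree and vertex connectivity\<close>

lemma out_degree_cycle_prefix_digraph:
  assumes k: "1 \<le> k" "k < n" and v: "v \<in> verts (cycle_prefix_digraph n k)"
  shows "out_degree (cycle_prefix_digraph n k) v = n - 1"
proof -
  obtain x where x: "x \<in> words {1..n} (n - k)" "v = word_coset n x"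
    using v by (auto simp: verts_cycle_prefix_digraph)
  have ne: "x \<noteq> []" using wordsD(1)[OF x(1)] k by auto
  have sub: "shifts {1..n} x \<subseteq> words {1..n} (n - k)"
    using shifts_in_words[OF x(1) _ ne] by blast
  have "out_arcs (cycle_prefix_digraph n k) v = (\<lambda>y. (v, word_coset n y)) ` shifts {1..n} x"
  proof (intro equalityI subsetI)
    fix e assume "e \<in> out_arcs (cycle_prefix_digraph n k) v"
    then obtain x' y where e: "e = (word_coset n x', word_coset n y)" "word_coset n x' = v"
      and x': "x' \<in> words {1..n} (n - k)" and y: "y \<in> shifts {1..n} x'"
      by (auto simp: out_arcs_def arcs_cycle_prefix_digraph[OF k])
    have "x' = x" using x x' e(2) inj_on_word_coset by (metis inj_on_def)
    then show "e \<in> (\<lambda>y. (v, word_coset n y)) ` shifts {1..n} x" using e y by simp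
  next
    fix e assume "e \<in> (\<lambda>y. (v, word_coset n y)) ` shifts {1..n} x"
    then show "e \<in> out_arcs (cycle_prefix_digraph n k) v"
      using x unfolding out_arcs_def arcs_cycle_prefix_digraph[OF k] by auto
  qed
  moreover have "inj_on (\<lambda>y. (v, word_coset n y)) (shifts {1..n} x)"
    using inj_on_subset[OF inj_on_word_coset sub] by (simp add: inj_on_def)
  ultimately show ?thesis
    using card_shifts[OF _ x(1) ne] by (simp add: out_degree_def card_image)
qed

text \<open>Pulling \<open>Z\<close> back to a set \<open>X\<close> of words does not increase its
  size, so \<open>shift_rel_connected\<close> applies, and its paths map to paths of cosets that
  avoid \<open>Z\<close>.\<close>

lemma strongly_connected_cycle_prefix_digraph_minus:
  assumes k: "1 \<le> k" "k < n"
    and Z: "Z \<subseteq> verts (cycle_prefix_digraph n k)" "card Z + 2 \<le> n"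
  shows "strongly_connected
    (cycle_prefix_digraph n k \<restriction> (verts (cycle_prefix_digraph n k) - Z))"
    (is "strongly_connected ?D")
proof -
  let ?W = "words {1..n} (n - k)"
  define X where "X = {x \<in> ?W. word_coset n x \<in> Z}"
  have fin: "finite ?W" by (simp add: finite_words)
  have "finite Z" using Z(1) fin by (auto simp: verts_cycle_prefix_digraph intro: finite_subset)
  have X: "finite X" "X \<subseteq> ?W" using fin by (auto simp: X_def)
  have "word_coset n ` X \<subseteq> Z" by (auto simp: X_def)
  then have "card X \<le> card Z"
    by (rule card_inj_on_le[OF inj_on_subset[OF inj_on_word_coset X(2)] _ \<open>finite Z\<close>])
  then have cardX: "card X + 2 \<le> card {1..n}" using Z(2) by simp
  have verts: "verts ?D = word_coset n ` (?W - X)"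
    by (auto simp: verts_cycle_prefix_digraph X_def)
  \<comment> \<open>Strong connectivity demands a nonempty vertex set: the different first letters
    already give \<open>n\<close> words, more than are deleted.\<close>
  have "{1..n} \<subseteq> hd ` ?W"
  proof
    fix c assume c: "c \<in> {1..n}"
    obtain y where "y \<in> ?W" "hd y = c"
      by (rule ex_word_starting_with[of "{1..n}" "n - k" c]) (use k c in auto)
    then show "c \<in> hd ` ?W" by blast
  qed
  then have "n \<le> card ?W"
    using surj_card_le[OF fin, of "{1..n}" hd] by simp
  then have "\<not> ?W \<subseteq> X" using card_mono[OF X(1), of ?W] cardX by auto
  then have "verts ?D \<noteq> {}" unfolding verts by blast
  moreover have "u \<rightarrow>\<^sup>*\<^bsub>?D\<^esub> v" if uv: "u \<in> verts ?D" "v \<in> verts ?D" for u v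
  proof -
    obtain x y where x: "x \<in> ?W - X" "u = word_coset n x" and y: "y \<in> ?W - X" "v = word_coset n y"
      using uv unfolding verts by blast
    have "(x, y) \<in> (shift_rel {1..n} (n - k) X)\<^sup>*"
      by (rule shift_rel_connected) (use k cardX X x y in auto)
    then have "(word_coset n x, word_coset n y) \<in> rtrancl_on (verts ?D) (arcs_ends ?D)"
    proof (induction rule: rtrancl_induct)
      case base
      show ?case using uv x by simp
    next
      case (step y z)
      have yz: "y \<in> ?W - X" "z \<in> ?W - X" "z \<in> shifts {1..n} y"
        using step(2) by (auto simp: shift_rel_def)
      then have "(word_coset n y, word_coset n z) \<in> arcs (cycle_prefix_digraph n k)"
        unfolding arcs_cycle_prefix_digraph[OF k] by blast
      moreover have V: "word_coset n y \<in> verts ?D" "word_coset n z \<in> verts ?D"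
        using yz unfolding verts by blast+
      ultimately have "(word_coset n y, word_coset n z) \<in> arcs ?D"
        by simp
      then have "(word_coset n y, word_coset n z) \<in> arcs_ends ?D"
        by (force simp: arcs_ends_def arc_to_ends_def)
      from rtrancl_on_into_rtrancl_on[OF step.IH this V(2)] show ?case .
    qed
    then show ?thesis by (simp add: reachable_def x y)
  qed
  ultimately show ?thesis by (simp add: strongly_connected_def)
qed

text \<open>\<open>Z\<close> consists of the \<open>n - 1\<close> out-neighbours of the coset of a
  word \<open>x\<close>, so its removal leaves that vertex without out-arcs. A word \<open>y\<close>
  starting with a letter other than the first two of \<open>x\<close> is neither \<open>x\<close>
  nor one of its shifts. The pair \<open>u\<close>, \<open>v\<close> also shows that the digraph is
  not complete.\<close>

lemma cycle_prefix_digraph_separator: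
  assumes k: "1 \<le> k" "2 \<le> n - k"
  obtains u v Z where "u \<in> verts (cycle_prefix_digraph n k)" "v \<in> verts (cycle_prefix_digraph n k)"
    "u \<noteq> v" "\<not> u \<rightarrow>\<^bsub>cycle_prefix_digraph n k\<^esub> v"
    "Z \<subseteq> verts (cycle_prefix_digraph n k)" "card Z = n - 1" "finite Z"
    "\<not> strongly_connected (cycle_prefix_digraph n k \<restriction> (verts (cycle_prefix_digraph n k) - Z))"
proof -
  let ?G = "cycle_prefix_digraph n k" and ?W = "words {1..n} (n - k)"
  have k': "1 \<le> k" "k < n" and n: "3 \<le> n" using k by auto
  have "?W \<noteq> {}" by (rule words_nonempty) auto
  then obtain x where x: "x \<in> ?W" by blast
  have len: "length x = n - k" using wordsD(1)[OF x] .
  have ne: "x \<noteq> []" using len k by auto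
  have "card {1..n} - card {x ! 0, x ! 1} \<le> card ({1..n} - {x ! 0, x ! 1})"
    by (rule diff_card_le_card_Diff) simp
  moreover have "card {x ! 0, x ! 1} \<le> 2" by (simp add: card_insert_if)
  moreover have "card {1..n} = n" by simp
  ultimately have "card ({1..n} - {x ! 0, x ! 1}) \<noteq> 0" using n by linarith
  then have "{1..n} - {x ! 0, x ! 1} \<noteq> {}" by (metis card.empty)
  then obtain c where c: "c \<in> {1..n}" "c \<noteq> x ! 0" "c \<noteq> x ! 1" by blast
  obtain y where y: "y \<in> ?W" "hd y = c"
    by (rule ex_word_starting_with[of "{1..n}" "n - k" c]) (use k' c in auto)
  have hd: "hd z = x ! 1" if "z \<in> shifts {1..n} x" for z
    using hd_shifts[OF x k(2) that] .
  have "x ! 1 \<noteq> x ! 0"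
    using len k wordsD(2)[OF x] by (subst nth_eq_iff_index_eq) auto
  then have xn: "x \<notin> shifts {1..n} x" using hd hd_conv_nth[OF ne] by metis
  have yn: "y \<notin> shifts {1..n} x" using hd c y(2) by metis
  have xy: "x \<noteq> y" using c(2) y(2) hd_conv_nth[OF ne] by metis
  let ?Z = "word_coset n ` shifts {1..n} x"
  have sub: "shifts {1..n} x \<subseteq> ?W" using shifts_in_words[OF x _ ne] by blast
  have inj: "inj_on (word_coset n) ?W" by (rule inj_on_word_coset)
  have ZV: "?Z \<subseteq> verts ?G" using sub by (auto simp: verts_cycle_prefix_digraph)
  have cardZ: "card ?Z = n - 1"
    using card_image[OF inj_on_subset[OF inj sub]] card_shifts[OF _ x ne] by simp
  have uZ: "word_coset n x \<notin> ?Z" "word_coset n y \<notin> ?Z"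
    using inj_on_image_mem_iff[OF inj x sub] inj_on_image_mem_iff[OF inj y(1) sub] xn yn by blast+
  have uv: "word_coset n x \<noteq> word_coset n y" using inj_on_eq_iff[OF inj x y(1)] xy by blast
  let ?D = "?G \<restriction> (verts ?G - ?Z)"
  have "w = word_coset n x" if "word_coset n x \<rightarrow>\<^sup>*\<^bsub>?D\<^esub> w" for w
    using that unfolding reachable_def
  proof (induction rule: rtrancl_on_induct)
    case (step a b)
    then have "word_coset n x \<rightarrow>\<^bsub>?G\<^esub> b"
      by (auto simp: arcs_ends_def arc_to_ends_def)
    moreover obtain z where "z \<in> ?W" "b = word_coset n z" "b \<notin> ?Z"
      using step by (auto simp: verts_cycle_prefix_digraph)
    ultimately show ?case using dominates_cycle_prefix_digraph_iff[OF k' x, of z] by blast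
  qed simp
  then have "\<not> word_coset n x \<rightarrow>\<^sup>*\<^bsub>?D\<^esub> word_coset n y" using uv by metis
  moreover have V: "word_coset n x \<in> verts ?G" "word_coset n y \<in> verts ?G"
    using x y by (auto simp: verts_cycle_prefix_digraph)
  ultimately have "\<not> strongly_connected ?D"
    using uZ by (auto simp: strongly_connected_def)
  moreover have "\<not> word_coset n x \<rightarrow>\<^bsub>?G\<^esub> word_coset n y"
    using dominates_cycle_prefix_digraph_iff[OF k' x y(1)] yn by blast
  ultimately show ?thesis
    using that[OF V uv _ ZV cardZ] finite_shifts[of "{1..n}" x] by blast
qed

theorem theorem22:
  fixes n k :: nat
  assumes "2 \<le> n" and "1 \<le> k" and "k \<le> n - 1"
  shows "(\<forall>v\<in>verts (cycle_prefix_digraph n k). out_degree (cycle_prefix_digraph n k) v = n - 1) \<and>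
    vertex_connectivity (cycle_prefix_digraph n k) = n - 1"
proof
  let ?G = "cycle_prefix_digraph n k" and ?W = "words {1..n} (n - k)"
  have k: "1 \<le> k" "k < n" using assms by auto
  show "\<forall>v\<in>verts ?G. out_degree ?G v = n - 1"
    using out_degree_cycle_prefix_digraph[OF k] by blast
  show "vertex_connectivity ?G = n - 1"
  proof (cases "n - k = 1")
    \<comment> \<open>One-letter words give the complete digraph on \<open>n\<close> vertices, for
      which \<open>vertex_connectivity\<close> takes its first branch.\<close>
    case True
    have W: "?W = (\<lambda>c. [c]) ` {1..n}"
      unfolding True by (auto simp: words_def length_Suc_conv)
    have "u \<rightarrow>\<^bsub>?G\<^esub> v" if uv: "u \<in> verts ?G" "v \<in> verts ?G" "u \<noteq> v" for u v
    proof -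
      obtain c d where c: "[c] \<in> ?W" "u = word_coset n [c]" and d: "[d] \<in> ?W" "v = word_coset n [d]"
        using uv(1,2) unfolding verts_cycle_prefix_digraph W by blast
      have "[d] \<in> shifts {1..n} [c]"
        using uv(3) c d by (auto simp: shifts_def words_def)
      then show ?thesis using dominates_cycle_prefix_digraph_iff[OF k c(1) d(1)] c d by simp
    qed
    moreover have "card (verts ?G) = card ?W"
      unfolding verts_cycle_prefix_digraph by (rule card_image[OF inj_on_word_coset])
    moreover have "card ?W = n"
      unfolding W by (simp add: card_image inj_on_def)
    ultimately show ?thesis by (simp add: vertex_connectivity_def)
  next
    case False
    then have "2 \<le> n - k" using k by simp
    then obtain u v Z where uv: "u \<in> verts ?G" "v \<in> verts ?G" "u \<noteq> v" "\<not> u \<rightarrow>\<^bsub>?G\<^esub> v"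
      and Z: "Z \<subseteq> verts ?G" "card Z = n - 1" "finite Z"
        "\<not> strongly_connected (?G \<restriction> (verts ?G - Z))"
      using cycle_prefix_digraph_separator[OF k(1)] by metis
    \<comment> \<open>\<open>Z\<close> attains \<open>n - 1\<close>, and deleting at most
      \<open>n - 2\<close> vertices leaves a strongly connected digraph.\<close>
    have "(LEAST c. \<exists>X. X \<subseteq> verts ?G \<and> finite X \<and> card X = c \<and>
        \<not> strongly_connected (?G \<restriction> (verts ?G - X))) = n - 1"
    proof (rule Least_equality)
      fix c assume "\<exists>X. X \<subseteq> verts ?G \<and> finite X \<and> card X = c \<and>
        \<not> strongly_connected (?G \<restriction> (verts ?G - X))"
      then obtain X where X: "X \<subseteq> verts ?G" "card X = c"
        "\<not> strongly_connected (?G \<restriction> (verts ?G - X))" by blast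
      then have "\<not> card X + 2 \<le> n"
        using strongly_connected_cycle_prefix_digraph_minus[OF k X(1)] by blast
      then show "n - 1 \<le> c" using X(2) by linarith
    qed (use Z in blast)
    then show ?thesis using uv by (auto simp: vertex_connectivity_def)
  qed
qed

end
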